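(* Let $n\ge 1$ be an integer. For the nanostar dendrimer $D_3[n]$ we have $$ABC(D_3[n])=6(2^n)-4+(18(2^n)-9)\sqrt{2}.$$
   Context: For a finite simple graph $G$, $ABC(G)=\sum_{uv\in E(G)}\sqrt{\frac{d_u+d_v-2}{d_ud_v}}$, where $d_u$ is the degree of $u$ in $G$ (atom-bond connectivity index). The dendrimer $D_3[n]$ is defined recursively. $D_3[0]$ consists of a central vertex joined by an edge to one vertex of each of three disjoint hexagons (6-cycles). For $n\ge 1$, $D_3[n]$ is obtained from $D_3[n-1]$ as follows: for each of the $3\cdot 2^{n-1}$ outermost hexagons (the hexagons added at the last step), let $p$ be the vertex of the hexagon opposite (at distance 3 in the hexagon) to the vertex by which it is attached; add a new vertex $b$ joined by an edge to $p$, and add two new disjoint hexagons, with $b$ joined by an edge to one vertex of each of them. *)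

theory Defs
  imports Complex_Main
begin

record 'a graph =
  verts :: "'a set"
  edges :: "'a set set"

definition finite_simple_graph :: "'a graph \<Rightarrow> bool" where
  "finite_simple_graph G \<longleftrightarrow>
     finite (verts G) \<and> (\<forall>e\<in>edges G. e \<subseteq> verts G \<and> card e = 2)"

definition degree :: "'a graph \<Rightarrow> 'a \<Rightarrow> nat" where
  "degree G u = card {e \<in> edges G. u \<in> e}"

(* Edges are unordered pairs, so the symmetric expressions d_u + d_v and d_u d_v are
   written as a sum and a product over the two endpoints; see ABC_edge_term. *)
definition ABC :: "'a graph \<Rightarrow> real" where
  "ABC G = (\<Sum>e\<in>edges G.
     sqrt (((\<Sum>u\<in>e. real (degree G u)) - 2) / (\<Prod>u\<in>e. real (degree G u))))"

lemma ABC_edge_term: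
  assumes "u \<noteq> v"
  shows "sqrt (((\<Sum>w\<in>{u, v}. real (degree G w)) - 2) / (\<Prod>w\<in>{u, v}. real (degree G w)))
       = sqrt ((real (degree G u) + real (degree G v) - 2)
               / (real (degree G u) * real (degree G v)))"
  using assms by simp

(* A hexagon is named by an address a and has vertices Hex a 0, ..., Hex a 5 in cyclic
   order; Hex a 0 is the vertex by which it is attached and Hex a 3 the opposite one.
   Branch [] is the central vertex, and Branch a is the new vertex joined to Hex a 3.
   The hexagons attached to Branch a have the addresses i # a. *)
datatype vertex = Branch "nat list" | Hex "nat list" nat

definition hexagon_verts :: "nat list \<Rightarrow> vertex set" where
  "hexagon_verts a = Hex a ` {..<6}"

definition hexagon_edges :: "nat list \<Rightarrow> vertex set set" where
  "hexagon_edges a = (\<lambda>k. {Hex a k, Hex a ((k + 1) mod 6)}) ` {..<6}"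

(* addresses of the hexagons added at step n *)
fun outermost :: "nat \<Rightarrow> nat list set" where
  "outermost 0 = {[0], [1], [2]}"
| "outermost (Suc n) = (\<Union>a\<in>outermost n. {0 # a, 1 # a})"

fun D3 :: "nat \<Rightarrow> vertex graph" where
  "D3 0 =
     \<lparr> verts = {Branch []} \<union> (\<Union>h\<in>{[0], [1], [2]}. hexagon_verts h),
       edges = (\<Union>h\<in>{[0], [1], [2]}. {{Branch [], Hex h 0}} \<union> hexagon_edges h) \<rparr>"
| "D3 (Suc n) =
     \<lparr> verts = verts (D3 n) \<union>
         (\<Union>a\<in>outermost n. {Branch a} \<union> (\<Union>h\<in>{0 # a, 1 # a}. hexagon_verts h)),
       edges = edges (D3 n) \<union>
         (\<Union>a\<in>outermost n. {{Hex a 3, Branch a}} \<union>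
            (\<Union>h\<in>{0 # a, 1 # a}. {{Branch a, Hex h 0}} \<union> hexagon_edges h)) \<rparr>"

lemma finite_outermost: "finite (outermost n)"
  by (induction n) auto

lemma card_outermost: "card (outermost n) = 3 * 2 ^ n"
proof (induction n)
  case (Suc n)
  have "card (outermost (Suc n)) = (\<Sum>a\<in>outermost n. card {0 # a, 1 # a})"
    unfolding outermost.simps
    by (rule card_UN_disjoint) (auto simp: finite_outermost)
  with Suc show ?case by simp
qed simp

lemma hexagon_edges_simple:
  "e \<in> hexagon_edges a \<Longrightarrow> e \<subseteq> hexagon_verts a \<and> card e = 2"
proof -
  assume "e \<in> hexagon_edges a"
  then obtain k where k: "k < 6" and e: "e = {Hex a k, Hex a ((k + 1) mod 6)}"
    by (auto simp: hexagon_edges_def)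
  have "k \<noteq> (k + 1) mod 6"
    using k by presburger
  with k e show ?thesis
    by (auto simp: hexagon_verts_def)
qed

lemma outermost_hexagon_subset:
  "a \<in> outermost n \<Longrightarrow> hexagon_verts a \<subseteq> verts (D3 n)"
  by (cases n) auto

lemma hexagon_verts_mem: "k < 6 \<Longrightarrow> Hex a k \<in> hexagon_verts a"
  by (simp add: hexagon_verts_def)

lemma finite_hexagon_verts: "finite (hexagon_verts a)"
  by (simp add: hexagon_verts_def)

lemma finite_simple_graph_D3: "finite_simple_graph (D3 n)"
proof (induction n)
  case 0
  show ?case
    by (auto simp: finite_simple_graph_def finite_hexagon_verts hexagon_verts_mem
        dest: hexagon_edges_simple)
next
  case (Suc n)
  have H3: "Hex a 3 \<in> verts (D3 n)" if "a \<in> outermost n" for a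
    using outermost_hexagon_subset[OF that] hexagon_verts_mem[of 3 a] by auto
  have "finite (verts (D3 (Suc n)))"
    using Suc by (auto simp: finite_simple_graph_def finite_outermost finite_hexagon_verts)
  moreover have "e \<subseteq> verts (D3 (Suc n)) \<and> card e = 2" if "e \<in> edges (D3 (Suc n))" for e
    using that Suc
    by (auto simp: finite_simple_graph_def hexagon_verts_mem H3 dest: hexagon_edges_simple)
  ultimately show ?case
    unfolding finite_simple_graph_def by blast
qed

end

theory Submission imports Defs begin

text \<open>
  Every edge of the dendrimer contributes one of only two values to the index.
  The term of an edge with an end of degree 2 is \<open>sqrt (1 / 2)\<close>, whatever the (positive)
  degree of the other end, because \<open>(2 + d - 2) / (2 * d) = 1 / 2\<close>. In a hexagon only the
  vertices 0 and 3 carry further edges, and these are not adjacent; so every hexagon edge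
  has an end of degree 2 (lemma \<open>ABC_term_hexagon_edge\<close>). The remaining edges, the links,
  join a branch vertex to vertex 0 or 3 of a hexagon; both ends have degree 3, and the term
  is \<open>sqrt (4 / 9) = 2 / 3\<close> (lemma \<open>ABC_term_link\<close>).

  It remains to count. There are \<open>3 * (2 ^ (n + 1) - 1)\<close> hexagons with 6 edges each. Each
  hexagon has a link at its vertex 0, and each of the \<open>3 * (2 ^ n - 1)\<close> hexagons that is not
  outermost has another at its vertex 3, which makes \<open>9 * 2 ^ n - 6\<close> links. The index
  is therefore \<open>6 * 3 * (2 * 2 ^ n - 1) / sqrt 2 + (9 * 2 ^ n - 6) * 2 / 3\<close>.
\<close>

section \<open>Hexagons and links\<close>

text \<open>
  The bound is strict, so that \<open>hexagons (Suc n)\<close> are the addresses of all hexagons of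
  \<open>D3 n\<close> and \<open>hexagons n\<close> are those of the hexagons that have been extended further.
\<close>
definition hexagons :: "nat \<Rightarrow> nat list set" where
  "hexagons n = (\<Union>m<n. outermost m)"

text \<open>
  The edges outside the hexagons, each named by the address of the hexagon it meets: at
  vertex 0, towards the centre, or at vertex 3, outwards. The branch vertex to which the
  hexagon \<open>h\<close> is attached has the address \<open>tl h\<close>; since \<open>tl [i] = []\<close>, this covers the
  central vertex as well.
\<close>
definition links :: "nat \<Rightarrow> vertex set set" where
  "links n = (\<lambda>h. {Branch (tl h), Hex h 0}) ` hexagons (Suc n)
     \<union> (\<lambda>a. {Hex a 3, Branch a}) ` hexagons n"

lemma hexagons_0: "hexagons 0 = {}"
  by (simp add: hexagons_def)

lemma hexagons_Suc: "hexagons (Suc n) = hexagons n \<union> outermost n"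
  by (auto simp: hexagons_def less_Suc_eq)

lemma hexagons_mono: "a \<in> hexagons n \<Longrightarrow> a \<in> hexagons (Suc n)"
  by (simp add: hexagons_Suc)

lemma finite_hexagons: "finite (hexagons n)"
  by (simp add: hexagons_def finite_outermost)

lemma length_outermost: "a \<in> outermost n \<Longrightarrow> length a = Suc n"
  by (induction n arbitrary: a) auto

lemma length_hexagons: "a \<in> hexagons n \<Longrightarrow> 0 < length a \<and> length a \<le> n"
  by (auto simp: hexagons_def dest: length_outermost)

lemma card_hexagons: "real (card (hexagons n)) = 3 * (2 ^ n - 1)"
proof (induction n)
  case 0
  show ?case by (simp add: hexagons_0)
next
  case (Suc n)
  have "hexagons n \<inter> outermost n = {}"
    using length_outermost length_hexagons by fastforce
  then show ?case
    using Suc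
    by (simp add: hexagons_Suc card_Un_disjoint finite_hexagons finite_outermost card_outermost)
qed

lemma Cons_in_hexagons:
  "i # a \<in> hexagons (Suc n) \<longleftrightarrow> a = [] \<and> i < 3 \<or> a \<in> hexagons n \<and> i < 2"
proof (induction n)
  case 0
  show ?case by (auto simp: hexagons_Suc hexagons_0)
next
  case (Suc n)
  have "i # a \<in> hexagons (Suc (Suc n)) \<longleftrightarrow>
      i # a \<in> hexagons (Suc n) \<or> a \<in> outermost n \<and> i < 2"
    unfolding hexagons_Suc[of "Suc n"] by auto
  then show ?case
    unfolding Suc by (auto simp: hexagons_Suc)
qed

lemma hexagon_edges_explicit:
  "hexagon_edges a = {{Hex a 0, Hex a 1}, {Hex a 1, Hex a 2}, {Hex a 2, Hex a 3},
     {Hex a 3, Hex a 4}, {Hex a 4, Hex a 5}, {Hex a 5, Hex a 0}}"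
proof -
  have "{..<6::nat} = {0, 1, 2, 3, 4, 5}" by auto
  then show ?thesis unfolding hexagon_edges_def by (simp del: One_nat_def)
qed

lemma edges_D3: "edges (D3 n) = (\<Union>h\<in>hexagons (Suc n). hexagon_edges h) \<union> links n"
proof (induction n)
  case 0
  show ?case by (auto simp: links_def hexagons_Suc hexagons_0)
next
  case (Suc n)
  have *: "hexagons (Suc (Suc n)) = hexagons (Suc n) \<union> (\<Union>a\<in>outermost n. {0 # a, 1 # a})"
    by (simp add: hexagons_Suc)
  have "links (Suc n) = links n \<union>
      (\<Union>a\<in>outermost n. {{Hex a 3, Branch a}} \<union> (\<Union>h\<in>{0 # a, 1 # a}. {{Branch a, Hex h 0}}))"
    unfolding links_def * by (auto simp: hexagons_Suc[of n] image_Un image_UN)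
  then show ?case
    unfolding D3.simps graph.select_convs Suc * by auto
qed

section \<open>Degrees\<close>

lemma finite_edges_D3: "finite (edges (D3 n))"
  by (simp add: edges_D3 links_def finite_hexagons hexagon_edges_def)

lemma degree_D3_pos: "e \<in> edges (D3 n) \<Longrightarrow> u \<in> e \<Longrightarrow> 0 < degree (D3 n) u"
  unfolding degree_def by (auto simp: card_gt_0_iff finite_edges_D3)

text \<open>
  Distinct hexagons share no vertex, so the hexagon edges at a vertex of \<open>h\<close> are edges
  of \<open>h\<close> itself, and the degree can be read off from the six edges of one hexagon.
\<close>
lemma edges_at_hexagon_vertex:
  assumes "h \<in> hexagons (Suc n)"
  shows "{e \<in> edges (D3 n). Hex h k \<in> e} = {e \<in> hexagon_edges h. Hex h k \<in> e}
    \<union> (if k = 0 then {{Branch (tl h), Hex h 0}} else {})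
    \<union> (if k = 3 \<and> h \<in> hexagons n then {{Hex h 3, Branch h}} else {})"
proof -
  have "h' = h" if "e \<in> hexagon_edges h'" "Hex h k \<in> e" for e h'
    using that by (auto simp: hexagon_edges_def)
  then have "{e \<in> \<Union>h\<in>hexagons (Suc n). hexagon_edges h. Hex h k \<in> e} = {e \<in> hexagon_edges h. Hex h k \<in> e}"
    using assms by blast
  moreover have "{e \<in> links n. Hex h k \<in> e} = (if k = 0 then {{Branch (tl h), Hex h 0}} else {})
    \<union> (if k = 3 \<and> h \<in> hexagons n then {{Hex h 3, Branch h}} else {})"
    using assms by (auto simp: links_def)
  moreover have "{e \<in> A \<union> B. P e} = {e \<in> A. P e} \<union> {e \<in> B. P e}" for A B and P :: "vertex set \<Rightarrow> bool"
    by blast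
  ultimately show ?thesis
    unfolding edges_D3 by (simp only: Un_assoc)
qed

lemma Collect_mem_insert:
  "{e \<in> insert a A. P e} = (if P a then insert a {e \<in> A. P e} else {e \<in> A. P e})"
  by auto

lemma degree_hexagon_vertex:
  assumes "h \<in> hexagons (Suc n)" and "k < 6"
  shows "degree (D3 n) (Hex h k) =
    2 + (if k = 0 then 1 else 0) + (if k = 3 \<and> h \<in> hexagons n then 1 else 0)"
proof -
  have "k = 0 \<or> k = 1 \<or> k = 2 \<or> k = 3 \<or> k = 4 \<or> k = 5"
    using assms(2) by linarith
  then show ?thesis
    unfolding degree_def edges_at_hexagon_vertex[OF assms(1)] hexagon_edges_explicit Collect_mem_insert
    by (elim disjE) (simp_all add: doubleton_eq_iff)
qed

lemma edges_at_branch: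
  "{e \<in> edges (D3 n). Branch a \<in> e} =
     (\<lambda>h. {Branch a, Hex h 0}) ` {h \<in> hexagons (Suc n). tl h = a}
     \<union> (if a \<in> hexagons n then {{Hex a 3, Branch a}} else {})"
proof -
  have "Branch a \<notin> e" if "e \<in> hexagon_edges h" for e h
    using that by (auto simp: hexagon_edges_def)
  then have "{e \<in> edges (D3 n). Branch a \<in> e} = {e \<in> links n. Branch a \<in> e}"
    unfolding edges_D3 by blast
  also have "\<dots> = (\<lambda>h. {Branch a, Hex h 0}) ` {h \<in> hexagons (Suc n). tl h = a}
     \<union> (if a \<in> hexagons n then {{Hex a 3, Branch a}} else {})"
    by (auto simp: links_def)
  finally show ?thesis .
qed

text \<open>
  The central vertex carries three hexagons; any other branch vertex carries two, and its
  third edge leads back to the hexagon that it extends.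
\<close>
lemma degree_branch:
  assumes "a = [] \<or> a \<in> hexagons n"
  shows "degree (D3 n) (Branch a) = 3"
proof -
  have attached: "{h \<in> hexagons (Suc n). tl h = a} = (\<lambda>i. i # a) ` (if a = [] then {..<3} else {..<2})"
  proof (intro set_eqI iffI)
    fix h assume h: "h \<in> {h \<in> hexagons (Suc n). tl h = a}"
    then obtain i where "h = i # a"
      using length_hexagons[of h "Suc n"] by (cases h) auto
    with h show "h \<in> (\<lambda>i. i # a) ` (if a = [] then {..<3} else {..<2})"
      by (auto simp: Cons_in_hexagons)
  qed (use assms in \<open>auto simp: Cons_in_hexagons split: if_splits\<close>)
  have nil: "[] \<notin> hexagons n"
    using length_hexagons by fastforce
  have inj: "inj_on (\<lambda>h. {Branch a, Hex h 0}) H" for H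
    by (auto simp: inj_on_def doubleton_eq_iff)
  have card_attached: "card ((\<lambda>h. {Branch a, Hex h 0}) ` {h \<in> hexagons (Suc n). tl h = a})
      = (if a = [] then 3 else 2)"
    unfolding card_image[OF inj] attached by (subst card_image) (auto simp: inj_on_def)
  show ?thesis
  proof (cases "a = []")
    case True
    then show ?thesis
      using nil card_attached by (simp add: degree_def edges_at_branch)
  next
    case False
    have "{Hex a 3, Branch a} \<notin> (\<lambda>h. {Branch a, Hex h 0}) ` {h \<in> hexagons (Suc n). tl h = a}"
      by (simp add: image_iff doubleton_eq_iff)
    moreover have "finite {h \<in> hexagons (Suc n). tl h = a}"
      by (simp add: finite_hexagons)
    ultimately show ?thesis
      using False assms card_attached by (simp add: degree_def edges_at_branch)
  qed
qed

section \<open>Edge terms\<close>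

definition ABC_term :: "'a graph \<Rightarrow> 'a set \<Rightarrow> real" where
  "ABC_term G e = sqrt (((\<Sum>u\<in>e. real (degree G u)) - 2) / (\<Prod>u\<in>e. real (degree G u)))"

lemma ABC_term_degree_2:
  assumes "u \<noteq> v" and "degree G u = 2" and "0 < degree G v"
  shows "ABC_term G {u, v} = sqrt (1 / 2)"
  using assms by (simp add: ABC_term_def)

text \<open>
  The vertices 0 and 3, the only ones that may have degree 3, are not adjacent in the
  hexagon.
\<close>
lemma ABC_term_hexagon_edge:
  assumes "h \<in> hexagons (Suc n)" and "e \<in> hexagon_edges h"
  shows "ABC_term (D3 n) e = sqrt (1 / 2)"
proof -
  \<comment> \<open>Each edge is listed with an end other than 0 and 3 first.\<close>
  have "e \<in> {{Hex h 1, Hex h 0}, {Hex h 1, Hex h 2}, {Hex h 2, Hex h 3},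
      {Hex h 4, Hex h 3}, {Hex h 4, Hex h 5}, {Hex h 5, Hex h 0}}"
    using assms(2) unfolding hexagon_edges_explicit by (auto simp: insert_commute)
  then obtain k l where e: "e = {Hex h k, Hex h l}" and k: "k \<in> {1, 2, 4, 5}" and "k \<noteq> l"
    by fastforce
  have "e \<in> edges (D3 n)"
    using assms by (auto simp: edges_D3)
  then have "0 < degree (D3 n) (Hex h l)"
    by (rule degree_D3_pos) (simp add: e)
  then show ?thesis
    unfolding e using \<open>k \<noteq> l\<close> k
    by (intro ABC_term_degree_2) (auto simp: degree_hexagon_vertex[OF assms(1)])
qed

lemma ABC_term_degree_3:
  assumes "u \<noteq> v" and "degree G u = 3" and "degree G v = 3"
  shows "ABC_term G {u, v} = 2 / 3"
proof -
  have "sqrt (4 / 9) = 2 / 3"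
    by (rule real_sqrt_unique) (auto simp: power2_eq_square)
  then show ?thesis
    using assms by (simp add: ABC_term_def)
qed

lemma ABC_term_link:
  assumes "e \<in> links n"
  shows "ABC_term (D3 n) e = 2 / 3"
  using assms unfolding links_def
proof (elim UnE imageE)
  fix h assume e: "e = {Branch (tl h), Hex h 0}" and h: "h \<in> hexagons (Suc n)"
  have "tl h = [] \<or> tl h \<in> hexagons n"
    using h by (cases h) (auto simp: Cons_in_hexagons)
  then show ?thesis
    unfolding e
    by (intro ABC_term_degree_3 degree_branch) (auto simp: degree_hexagon_vertex h)
next
  fix a assume e: "e = {Hex a 3, Branch a}" and a: "a \<in> hexagons n"
  then show ?thesis
    unfolding e
    by (intro ABC_term_degree_3 degree_branch) (auto simp: degree_hexagon_vertex hexagons_mono)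
qed

section \<open>Counting the edges\<close>

lemma card_hexagon_edges: "card (hexagon_edges a) = 6"
  by (simp add: hexagon_edges_explicit doubleton_eq_iff)

lemma card_all_hexagon_edges:
  "real (card (\<Union>h\<in>hexagons (Suc n). hexagon_edges h)) = 18 * (2 * 2 ^ n - 1)"
proof -
  have "card (\<Union>h\<in>hexagons (Suc n). hexagon_edges h) = (\<Sum>h\<in>hexagons (Suc n). card (hexagon_edges h))"
    by (rule card_UN_disjoint) (auto simp: finite_hexagons hexagon_edges_def doubleton_eq_iff)
  then show ?thesis
    using card_hexagons[of "Suc n"] by (simp add: card_hexagon_edges)
qed

lemma card_links: "real (card (links n)) = 9 * 2 ^ n - 6"
proof -
  have "card (links n) = card (hexagons (Suc n)) + card (hexagons n)"
    unfolding links_def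
  proof (subst card_Un_disjoint)
    have "{Branch (tl h), Hex h 0} \<noteq> {Hex a 3, Branch a}" for h a
      by (simp add: doubleton_eq_iff)
    then show "(\<lambda>h. {Branch (tl h), Hex h 0}) ` hexagons (Suc n) \<inter>
        (\<lambda>a. {Hex a 3, Branch a}) ` hexagons n = {}"
      by blast
    have "inj_on (\<lambda>h. {Branch (tl h), Hex h 0}) H" for H
      by (simp add: inj_on_def doubleton_eq_iff)
    moreover have "inj_on (\<lambda>a. {Hex a 3, Branch a}) H" for H
      by (simp add: inj_on_def doubleton_eq_iff)
    ultimately show "card ((\<lambda>h. {Branch (tl h), Hex h 0}) ` hexagons (Suc n)) +
        card ((\<lambda>a. {Hex a 3, Branch a}) ` hexagons n) = card (hexagons (Suc n)) + card (hexagons n)"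
      by (simp only: card_image)
  qed (simp_all add: finite_hexagons)
  then show ?thesis
    using card_hexagons[of n] card_hexagons[of "Suc n"] by simp
qed

theorem theorem3p13:
  fixes n :: nat
  assumes "n \<ge> 1"
  shows "ABC (D3 n) = 6 * 2 ^ n - 4 + (18 * 2 ^ n - 9) * sqrt 2"
proof -
  let ?H = "\<Union>h\<in>hexagons (Suc n). hexagon_edges h"
  have "?H \<inter> links n = {}"
    by (auto simp: links_def hexagon_edges_explicit doubleton_eq_iff)
  moreover have "finite ?H" "finite (links n)"
    using finite_edges_D3[of n] by (simp_all add: edges_D3)
  ultimately have "ABC (D3 n) = sum (ABC_term (D3 n)) ?H + sum (ABC_term (D3 n)) (links n)"
    unfolding ABC_def ABC_term_def[symmetric] edges_D3 by (intro sum.union_disjoint) auto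
  also have "sum (ABC_term (D3 n)) ?H = (\<Sum>e\<in>?H. sqrt (1 / 2))"
    by (intro sum.cong refl) (auto simp: ABC_term_hexagon_edge)
  also have "\<dots> = 18 * (2 * 2 ^ n - 1) * sqrt (1 / 2)"
    by (simp only: sum_constant card_all_hexagon_edges)
  also have "sqrt (1 / 2) = sqrt 2 / 2"
    by (simp add: real_sqrt_divide real_div_sqrt field_simps)
  also have "sum (ABC_term (D3 n)) (links n) = (\<Sum>e\<in>links n. 2 / 3)"
    by (intro sum.cong refl ABC_term_link)
  also have "\<dots> = (9 * 2 ^ n - 6) * (2 / 3)"
    by (simp only: sum_constant card_links)
  finally show ?thesis
    by (simp add: algebra_simps)
qed

end
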